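(* Let $k$ be a field of characteristic zero and let $[T_0U_0]$ be the differential ideal of $k\{T,U\}$ generated by $T_0U_0$. For every pair of integers $i,j\geq 0$, the least positive integer $q$ such that $(T_iU_j)^{q}\in [T_0U_0]$ (that is, the nilpotency index of the image of $T_iU_j$ in $k\{T,U\}/[T_0U_0]$) equals $i+j+1$.
   Context: $k\{T,U\}$ denotes the polynomial $k$-algebra $k[T_i,U_j;\ i,j\in\mathbb{Z}_{\geq 0}]$ endowed with the $k$-linear derivation $\partial$ defined by $\partial T_i=T_{i+1}$ and $\partial U_j=U_{j+1}$ for all $i,j\geq 0$. The differential ideal generated by an element $f$ is the smallest ideal containing $f$ and stable under $\partial$, i.e. the ideal generated by $\partial^n(f)$, $n\geq 0$. *)

theory Defs
  imports Complex_Main "HOL-Library.Poly_Mapping"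
begin

datatype diff_var = TVar nat | UVar nat

primrec next_var :: "diff_var \<Rightarrow> diff_var" where
  "next_var (TVar i) = TVar (Suc i)"
| "next_var (UVar j) = UVar (Suc j)"

text \<open>
  The polynomial ring over \<open>'k\<close> in the indeterminates \<^typ>\<open>diff_var\<close>: finitely supported
  coefficient functions on monomials, a monomial being a finitely supported exponent function.
  Multiplication is the convolution product of \<^theory>\<open>HOL-Library.Poly_Mapping\<close>, and the
  constant polynomial \<open>c\<close> is \<open>Poly_Mapping.single 0 c\<close>.
\<close>
type_synonym 'k kTU = "(diff_var \<Rightarrow>\<^sub>0 nat) \<Rightarrow>\<^sub>0 'k"

definition var :: "diff_var \<Rightarrow> 'k::comm_ring_1 kTU" where
  "var v = Poly_Mapping.single (Poly_Mapping.single v 1) 1"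

abbreviation T :: "nat \<Rightarrow> 'k::comm_ring_1 kTU" where "T i \<equiv> var (TVar i)"
abbreviation U :: "nat \<Rightarrow> 'k::comm_ring_1 kTU" where "U j \<equiv> var (UVar j)"

text \<open>
  The sum over \<open>v\<close> of \<open>next_var v\<close> times the formal partial derivative with respect to \<open>v\<close>,
  written out on monomials. The lemmas below show that it is the unique \<open>'k\<close>-linear derivation
  sending each indeterminate to the next one.
\<close>
definition tu_deriv :: "'k::comm_ring_1 kTU \<Rightarrow> 'k kTU" (\<open>\<partial>\<close>) where
  "\<partial> p = (\<Sum>m\<in>Poly_Mapping.keys p. \<Sum>v\<in>Poly_Mapping.keys m.
     Poly_Mapping.single (m - Poly_Mapping.single v 1 + Poly_Mapping.single (next_var v) 1)
       (Poly_Mapping.lookup p m * of_nat (Poly_Mapping.lookup m v)))"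

text \<open>Ideals of a commutative ring are its submodules as a module over itself.\<close>
interpretation ideal: module "times :: 'a::comm_ring_1 \<Rightarrow> 'a \<Rightarrow> 'a"
  by standard (simp_all add: algebra_simps)

(* as a simp rule it loops with the associativity law mult.assoc *)
declare ideal.scale_scale [simp del]

definition diff_ideal :: "'k::comm_ring_1 kTU \<Rightarrow> 'k kTU set" where
  "diff_ideal f = (\<lambda>I. ideal.subspace I \<and> (\<forall>p\<in>I. \<partial> p \<in> I)) hull {f}"

lemma tu_deriv_sum_superset:
  fixes p :: "'k::comm_ring_1 kTU"
  assumes "finite S" "Poly_Mapping.keys p \<subseteq> S"
  shows "\<partial> p = (\<Sum>m\<in>S. \<Sum>v\<in>Poly_Mapping.keys m.
     Poly_Mapping.single (m - Poly_Mapping.single v 1 + Poly_Mapping.single (next_var v) 1)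
       (Poly_Mapping.lookup p m * of_nat (Poly_Mapping.lookup m v)))"
  unfolding tu_deriv_def using assms
  by (intro sum.mono_neutral_left) (auto simp: in_keys_iff)

lemma tu_deriv_zero [simp]: "\<partial> 0 = 0"
  by (simp add: tu_deriv_def)

lemma tu_deriv_add: "\<partial> (p + q) = \<partial> p + \<partial> q"
proof -
  let ?S = "Poly_Mapping.keys p \<union> Poly_Mapping.keys q"
  have S: "finite ?S" "Poly_Mapping.keys p \<subseteq> ?S" "Poly_Mapping.keys q \<subseteq> ?S"
    "Poly_Mapping.keys (p + q) \<subseteq> ?S"
    using keys_add[of p q] by auto
  show ?thesis
    unfolding tu_deriv_sum_superset[OF S(1,2)] tu_deriv_sum_superset[OF S(1,3)]
      tu_deriv_sum_superset[OF S(1,4)]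
    by (simp add: lookup_add distrib_right single_add sum.distrib)
qed

lemma tu_deriv_single:
  fixes c :: "'k::comm_ring_1"
  assumes "finite A" "Poly_Mapping.keys m \<subseteq> A"
  shows "\<partial> (Poly_Mapping.single m c) = (\<Sum>v\<in>A.
     Poly_Mapping.single (m - Poly_Mapping.single v 1 + Poly_Mapping.single (next_var v) 1)
       (c * of_nat (Poly_Mapping.lookup m v)))"
proof -
  have "Poly_Mapping.keys (Poly_Mapping.single m c) \<subseteq> {m}" by simp
  from tu_deriv_sum_superset[OF _ this]
  have "\<partial> (Poly_Mapping.single m c) = (\<Sum>v\<in>Poly_Mapping.keys m.
     Poly_Mapping.single (m - Poly_Mapping.single v 1 + Poly_Mapping.single (next_var v) 1)
       (c * of_nat (Poly_Mapping.lookup m v)))"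
    by simp
  also have "\<dots> = (\<Sum>v\<in>A.
     Poly_Mapping.single (m - Poly_Mapping.single v 1 + Poly_Mapping.single (next_var v) 1)
       (c * of_nat (Poly_Mapping.lookup m v)))"
    using assms by (intro sum.mono_neutral_left) (auto simp: in_keys_iff)
  finally show ?thesis .
qed

lemma kTU_induct [case_names single add]:
  fixes p :: "'k::comm_ring_1 kTU"
  assumes s: "\<And>m c. P (Poly_Mapping.single m c)"
    and a: "\<And>p q. P p \<Longrightarrow> P q \<Longrightarrow> P (p + q)"
  shows "P p"
proof -
  have "P (\<Sum>m\<in>S. Poly_Mapping.single m (Poly_Mapping.lookup p m))" if "finite S" for S
    using that
  proof induction
    case empty
    then show ?case using s[of 0 0] by simp
  qed (auto intro: s a)
  moreover have "p = (\<Sum>m\<in>Poly_Mapping.keys p. Poly_Mapping.single m (Poly_Mapping.lookup p m))"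
    by (rule poly_mapping_eqI) (auto simp: lookup_sum lookup_single when_def in_keys_iff)
  ultimately show ?thesis by (metis finite_keys)
qed

lemma single_shift_mult:
  fixes m n :: "diff_var \<Rightarrow>\<^sub>0 nat" and c d :: "'k::comm_ring_1"
  shows "Poly_Mapping.single (m + n - Poly_Mapping.single v 1 + w) (c * d * of_nat (Poly_Mapping.lookup m v))
    = Poly_Mapping.single (m - Poly_Mapping.single v 1 + w) (c * of_nat (Poly_Mapping.lookup m v))
      * Poly_Mapping.single n d"
proof (cases "Poly_Mapping.lookup m v = 0")
  case False
  have "m + n - Poly_Mapping.single v 1 = m - Poly_Mapping.single v 1 + n"
    using False
    by (intro poly_mapping_eqI) (auto simp: lookup_add lookup_minus lookup_single when_def)
  then show ?thesis by (simp add: mult_single ac_simps)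
qed simp

lemma tu_deriv_mult: "\<partial> (p * q) = \<partial> p * q + p * \<partial> q"
proof (induction p rule: kTU_induct)
  case (single m c)
  show ?case
  proof (induction q rule: kTU_induct)
    case (single n d)
    let ?A = "Poly_Mapping.keys m \<union> Poly_Mapping.keys n"
    let ?g = "\<lambda>v. Poly_Mapping.single v (1::nat)"
    let ?h = "\<lambda>v. Poly_Mapping.single (next_var v) (1::nat)"
    have A: "finite ?A" "Poly_Mapping.keys m \<subseteq> ?A" "Poly_Mapping.keys n \<subseteq> ?A"
      "Poly_Mapping.keys (m + n) \<subseteq> ?A"
      using keys_add[of m n] by auto
    have *: "Poly_Mapping.single (m + n - ?g v + ?h v) (c * d * of_nat (Poly_Mapping.lookup (m + n) v))
      = Poly_Mapping.single (m - ?g v + ?h v) (c * of_nat (Poly_Mapping.lookup m v)) * Poly_Mapping.single n d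
      + Poly_Mapping.single m c * Poly_Mapping.single (n - ?g v + ?h v) (d * of_nat (Poly_Mapping.lookup n v))"
      for v
      using single_shift_mult[of m n v "?h v" c d] single_shift_mult[of n m v "?h v" d c]
      by (simp add: lookup_add distrib_left single_add ac_simps)
    show ?case
      unfolding mult_single tu_deriv_single[OF A(1,2)] tu_deriv_single[OF A(1,3)]
        tu_deriv_single[OF A(1,4)] *
      by (simp add: sum.distrib sum_distrib_left sum_distrib_right mult_single)
  next
    case (add q r)
    then show ?case by (simp add: algebra_simps tu_deriv_add)
  qed
next
  case (add p r)
  then show ?case by (simp add: algebra_simps tu_deriv_add)
qed

lemma tu_deriv_const [simp]: "\<partial> (Poly_Mapping.single 0 c) = 0"
  by (subst tu_deriv_single[of "{}"]) auto

lemma tu_deriv_var [simp]: "\<partial> (var v) = var (next_var v)"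
  unfolding var_def by (subst tu_deriv_single[of "{v}"]) auto

lemma tu_deriv_unique:
  fixes D :: "'k::comm_ring_1 kTU \<Rightarrow> 'k kTU"
  assumes add: "\<And>p q. D (p + q) = D p + D q"
    and leibniz: "\<And>p q. D (p * q) = D p * q + p * D q"
    and const: "\<And>c. D (Poly_Mapping.single 0 c) = 0"
    and var: "\<And>v. D (var v) = var (next_var v)"
  shows "D = \<partial>"
proof
  fix p :: "'k kTU"
  have one: "D 1 = \<partial> 1" using const[of 1] tu_deriv_const[of 1] by simp
  have pow: "D (var v ^ k) = \<partial> (var v ^ k)" for v k
    by (induction k) (simp_all add: one leibniz var tu_deriv_mult)
  have vpow: "var v ^ k = Poly_Mapping.single (Poly_Mapping.single v k) (1::'k)" for v k
    by (induction k) (simp_all add: var_def mult_single single_add[symmetric])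
  have mon: "D (Poly_Mapping.single (\<Sum>v\<in>A. Poly_Mapping.single v (e v)) 1)
      = \<partial> (Poly_Mapping.single (\<Sum>v\<in>A. Poly_Mapping.single v (e v)) 1)"
    if "finite A" for A and e :: "diff_var \<Rightarrow> nat"
    using that
  proof induction
    case empty
    then show ?case using one by simp
  next
    case (insert v A)
    have "Poly_Mapping.single (\<Sum>v\<in>insert v A. Poly_Mapping.single v (e v)) (1::'k)
      = var v ^ e v * Poly_Mapping.single (\<Sum>v\<in>A. Poly_Mapping.single v (e v)) 1"
      using insert by (simp add: vpow mult_single)
    then show ?case by (simp only: leibniz tu_deriv_mult pow insert.IH)
  qed
  have exp: "m = (\<Sum>v\<in>Poly_Mapping.keys m. Poly_Mapping.single v (Poly_Mapping.lookup m v))"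
    for m :: "diff_var \<Rightarrow>\<^sub>0 nat"
    by (rule poly_mapping_eqI) (auto simp: lookup_sum lookup_single when_def in_keys_iff)
  show "D p = \<partial> p"
  proof (induction p rule: kTU_induct)
    case (single m c)
    have "D (Poly_Mapping.single m 1) = \<partial> (Poly_Mapping.single m 1)"
      using mon[where e = "Poly_Mapping.lookup m", OF finite_keys[of m]] by (simp only: exp[symmetric])
    moreover have "Poly_Mapping.single m c = Poly_Mapping.single 0 c * Poly_Mapping.single m 1"
      by (simp add: mult_single)
    ultimately show ?case by (simp only: leibniz tu_deriv_mult const tu_deriv_const)
  qed (simp add: add tu_deriv_add)
qed

lemma diff_ideal_eq_span: "diff_ideal f = ideal.span (range (\<lambda>n. (\<partial> ^^ n) f))"
  unfolding diff_ideal_def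
proof (rule hull_unique)
  let ?S = "range (\<lambda>n. (\<partial> ^^ n) f)"
  show "{f} \<subseteq> ideal.span ?S"
    by (auto intro!: ideal.span_base range_eqI[of _ _ 0])
  have "\<partial> p \<in> ideal.span ?S" if "p \<in> ideal.span ?S" for p
    using that
  proof (induction rule: ideal.span_induct_alt)
    case base
    then show ?case by (simp add: ideal.span_zero)
  next
    case (step c x y)
    then obtain n where x: "x = (\<partial> ^^ n) f" by auto
    have "\<partial> x = (\<partial> ^^ Suc n) f" by (simp add: x)
    then have "\<partial> x \<in> ideal.span ?S"
      by (simp only:) (intro ideal.span_base rangeI)
    moreover have "x \<in> ideal.span ?S" using step by (auto intro: ideal.span_base)
    ultimately show ?case using step
      by (simp add: tu_deriv_add tu_deriv_mult ideal.span_add ideal.span_scale)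
  qed
  then show "ideal.subspace (ideal.span ?S) \<and> (\<forall>p\<in>ideal.span ?S. \<partial> p \<in> ideal.span ?S)"
    by simp
next
  fix I assume "{f} \<subseteq> I" and I: "ideal.subspace I \<and> (\<forall>p\<in>I. \<partial> p \<in> I)"
  then have "(\<partial> ^^ n) f \<in> I" for n by (induction n) auto
  then show "ideal.span (range (\<lambda>n. (\<partial> ^^ n) f)) \<subseteq> I"
    using I by (intro ideal.span_minimal) auto
qed

end

theory Submission
  imports Defs
begin

text \<open>
  Put \<open>x\<^sub>a = T\<^sub>a / a!\<close> and \<open>y\<^sub>b = U\<^sub>b / b!\<close>. The differential ideal is then generated by the
  coefficients \<open>g\<^sub>N = \<Sum>\<^bsub>a+b=N\<^esub> x\<^sub>a y\<^sub>b\<close> of the product of the two generating series.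

  Upper bound: modulo the \<open>g\<^sub>N\<close>, a product of one \<open>x\<close> with \<open>q\<close> of the \<open>y\<close> is a combination of
  such products of the same weight (sum of the indices) in which the index of \<open>x\<close> is at
  least \<open>q\<close>. Applying this to each \<open>x\<close> in turn, a monomial with \<open>p\<close> factors \<open>x\<close>, \<open>q\<close> factors \<open>y\<close>
  and weight less than \<open>p q\<close> lies in the ideal; \<open>(x\<^sub>i y\<^sub>j)\<^bsup>i+j+1\<^esup>\<close> is one.

  Lower bound: put \<open>n = i + j\<close>. Pairing a polynomial with \<open>\<Prod>\<^bsub>r,c<n\<^esub> (s\<^sub>r - t\<^sub>c)\<close>, where the exponents
  of the \<open>s\<^sub>r\<close> and \<open>t\<^sub>c\<close> are read as indices of \<open>x\<close> and \<open>y\<close>, kills every multiple of \<open>g\<^sub>N\<close>, because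
  the product vanishes for \<open>s\<^sub>r = t\<^sub>c\<close>. Expanding the product turns it into a signed sum over the
  \<open>n \<times> n\<close> matrices with entries 0 and 1, and vanishing into cancellation under flipping one entry.
  On \<open>(T\<^sub>i U\<^sub>j)\<^sup>n\<close> the functional counts, up to a non-zero factor, the matrices with all row and
  column sums equal to \<open>i\<close>, and a circulant matrix is one.
\<close>

section \<open>The upper bound\<close>

lemma subspace_quotient:
  fixes z :: "'a::comm_ring_1"
  assumes "ideal.subspace H"
  shows "ideal.subspace {h. h * z \<in> H}"
  using assms unfolding ideal.subspace_def by (simp add: distrib_right mult.assoc)

text \<open>Two nested inductions: on the number \<open>q\<close> of \<open>y\<close> factors and,
  for terms whose \<open>x\<close> index is exactly \<open>q\<close>, on the weight of the
  \<open>y\<close> factors other than \<open>y d\<close>.\<close>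

lemma raise_index:
  fixes x y :: "nat \<Rightarrow> 'a::comm_ring_1"
  assumes "ideal.subspace H"
    and "\<And>N. (\<Sum>a\<le>N. x a * y (N - a)) \<in> H"
    and "\<And>a c. length c = q \<Longrightarrow> q \<le> a \<Longrightarrow> a + sum_list c = w \<Longrightarrow> x a * prod_list (map y c) \<in> H"
    and "length c = q" and "a + sum_list c = w"
  shows "x a * prod_list (map y c) \<in> H"
  using assms
  \<comment> \<open>The ideal varies in the induction: to carry a factor \<open>y e\<close> along, pass to the colon ideal.\<close>
proof (induction q arbitrary: H w a c)
  case 0
  then show ?case by simp
next
  case (Suc q)
  note H = \<open>ideal.subspace H\<close> and f = Suc.prems(2) and high = Suc.prems(3)
  \<comment> \<open>The outer hypothesis leaves only index \<open>q\<close> to check: a larger index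
    is at least \<open>Suc q\<close> and falls under \<open>high\<close>.\<close>
  have colon: "x a * prod_list (map y c) * y e \<in> H"
    if "length c = q" "a + sum_list c + e = w"
      and at_q: "\<And>c'. length c' = q \<Longrightarrow> q + sum_list c' = a + sum_list c \<Longrightarrow>
            x q * prod_list (map y c') * y e \<in> H"
    for a c e
  proof -
    have "x a' * prod_list (map y c') \<in> {h. h * y e \<in> H}"
      if c': "length c' = q" "q \<le> a'" "a' + sum_list c' = a + sum_list c" for a' c'
    proof (cases "a' = q")
      case True
      then show ?thesis using at_q c' by simp
    next
      case False
      then show ?thesis
        using high[of "e # c'" a'] c' \<open>a + sum_list c + e = w\<close> by (simp add: ac_simps)
    qed
    moreover have "(\<Sum>a\<le>N. x a * y (N - a)) \<in> {h. h * y e \<in> H}" for N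
      using ideal.subspace_scale[OF H f[of N], of "y e"] by (simp add: ac_simps)
    ultimately show ?thesis
      using Suc.IH[OF subspace_quotient[OF H, of "y e"], where w = "a + sum_list c" and c = c and a = a] that(1)
      by blast
  qed
  have at_q: "x q * prod_list (map y c) * y d \<in> H" if "length c = q" "q + sum_list c + d = w" for c d
    using that
  proof (induction "sum_list c" arbitrary: c d rule: less_induct)
    case less
    \<comment> \<open>Solve the relation of weight \<open>q + d\<close>, multiplied by
      \<open>prod_list (map y c)\<close>, for its term at \<open>q\<close>. Terms above
      \<open>q\<close> fall under \<open>high\<close>; those below lead through \<open>colon\<close>
      back to index \<open>q\<close> with a smaller \<open>sum_list\<close>.\<close>
    let ?t = "\<lambda>a. x a * y (q + d - a) * prod_list (map y c)"
    have "(\<Sum>a\<le>q + d. ?t a) \<in> H"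
      using ideal.subspace_scale[OF H f[of "q + d"], of "prod_list (map y c)"]
      by (simp add: sum_distrib_left ac_simps)
    moreover have "(\<Sum>a\<in>{..q + d} - {q}. ?t a) \<in> H"
    proof (rule ideal.subspace_sum[OF H])
      fix a assume a: "a \<in> {..q + d} - {q}"
      show "?t a \<in> H"
      proof (cases "a < q")
        case True
        have "x a * prod_list (map y c) * y (q + d - a) \<in> H"
        proof (rule colon)
          fix c' assume c': "length c' = q" "q + sum_list c' = a + sum_list c"
          then show "x q * prod_list (map y c') * y (q + d - a) \<in> H"
            using less.prems True by (intro less.hyps) auto
        qed (use less.prems True in auto)
        then show ?thesis by (simp add: ac_simps)
      next
        case False
        then show ?thesis
          using high[of "(q + d - a) # c" a] a less.prems by (simp add: ac_simps)
      qed
    qed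
    moreover have "(\<Sum>a\<le>q + d. ?t a) = ?t q + (\<Sum>a\<in>{..q + d} - {q}. ?t a)"
      by (rule sum.remove) auto
    ultimately have "?t q \<in> H"
      using ideal.subspace_diff[OF H, of "\<Sum>a\<le>q + d. ?t a" "\<Sum>a\<in>{..q + d} - {q}. ?t a"] by simp
    then show ?case by (simp add: ac_simps)
  qed
  obtain d c0 where c: "c = d # c0" "length c0 = q"
    using Suc.prems(4) by (auto simp: length_Suc_conv)
  have "x a * prod_list (map y c0) * y d \<in> H"
    using colon[OF c(2), of a d] at_q c Suc.prems(5) by (simp add: ac_simps)
  then show ?case using c by (simp add: ac_simps)
qed

text \<open>Once the first index is at least \<open>length bs\<close>, removing that
  \<open>x\<close> lowers the weight by at least \<open>length bs\<close>, which is the drop of the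
  bound, so the shorter list satisfies the hypothesis.\<close>

lemma low_weight_mem:
  fixes x y :: "nat \<Rightarrow> 'a::comm_ring_1"
  assumes J: "ideal.subspace J" and f: "\<And>N. (\<Sum>a\<le>N. x a * y (N - a)) \<in> J"
    and "sum_list as + sum_list bs < length as * length bs"
  shows "prod_list (map x as) * prod_list (map y bs) \<in> J"
  using assms(3)
proof (induction as arbitrary: bs)
  case Nil
  then show ?case by simp
next
  case (Cons a as)
  let ?H = "{h. h * prod_list (map x as) \<in> J}"
  have "x a * prod_list (map y bs) \<in> ?H"
  proof (rule raise_index[where q = "length bs" and w = "a + sum_list bs"])
    show "ideal.subspace ?H" by (rule subspace_quotient[OF J])
    show "(\<Sum>a\<le>N. x a * y (N - a)) \<in> ?H" for N
      using ideal.subspace_scale[OF J f[of N], of "prod_list (map x as)"] by (simp add: ac_simps)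
    show "x a' * prod_list (map y c) \<in> ?H"
      if "length c = length bs" "length bs \<le> a'" "a' + sum_list c = a + sum_list bs" for a' c
    proof -
      have "prod_list (map x as) * prod_list (map y c) \<in> J"
        using that Cons.prems by (intro Cons.IH) simp
      from ideal.subspace_scale[OF J this, of "x a'"] show ?thesis by (simp add: ac_simps)
    qed
  qed auto
  then show ?case by (simp add: ac_simps)
qed

text \<open>The weight \<open>(i + j + 1) * (i + j)\<close> is below
  \<open>(i + j + 1) * (i + j + 1)\<close>.\<close>

lemma power_mult_mem:
  fixes x y :: "nat \<Rightarrow> 'a::comm_ring_1"
  assumes "ideal.subspace J" and "\<And>N. (\<Sum>a\<le>N. x a * y (N - a)) \<in> J"
  shows "(x i * y j) ^ (i + j + 1) \<in> J"
  using low_weight_mem[OF assms, where as = "replicate (i + j + 1) i" and bs = "replicate (i + j + 1) j"]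
  by (simp add: sum_list_replicate power_mult_distrib algebra_simps)

section \<open>Divided variables\<close>

abbreviation const :: "'k \<Rightarrow> 'k::comm_ring_1 kTU" where
  "const \<equiv> Poly_Mapping.single 0"

definition divT :: "nat \<Rightarrow> 'k::field_char_0 kTU" where
  "divT a = Poly_Mapping.single (Poly_Mapping.single (TVar a) 1) (1 / fact a)"

definition divU :: "nat \<Rightarrow> 'k::field_char_0 kTU" where
  "divU a = Poly_Mapping.single (Poly_Mapping.single (UVar a) 1) (1 / fact a)"

definition conv_TU :: "nat \<Rightarrow> 'k::field_char_0 kTU" where
  "conv_TU N = (\<Sum>a\<le>N. divT a * divU (N - a))"

lemma divT_eq: "divT a = const (1 / fact a) * T a"
  and divU_eq: "divU a = const (1 / fact a) * U a"
  by (simp_all add: divT_def divU_def var_def mult_single)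

lemma of_nat_kTU: "of_nat n = (const (of_nat n) :: 'k::comm_ring_1 kTU)"
  by (induction n) (simp_all add: single_add)

lemma T_eq: "T a = const (fact a) * (divT a :: 'k::field_char_0 kTU)"
  and U_eq: "U a = const (fact a) * (divU a :: 'k::field_char_0 kTU)"
  by (simp_all add: divT_def divU_def var_def mult_single)

lemma tu_deriv_divT: "\<partial> (divT a :: 'k::field_char_0 kTU) = of_nat (Suc a) * divT (Suc a)"
  and tu_deriv_divU: "\<partial> (divU a :: 'k::field_char_0 kTU) = of_nat (Suc a) * divU (Suc a)"
proof -
  have c: "of_nat (Suc a) * const (1 / fact (Suc a)) = (const (1 / fact a) :: 'k kTU)"
    unfolding of_nat_kTU mult_single by (simp add: field_simps del: of_nat_Suc)
  show "\<partial> (divT a :: 'k kTU) = of_nat (Suc a) * divT (Suc a)"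
    unfolding divT_eq mult.assoc[symmetric] c by (simp add: tu_deriv_mult)
  show "\<partial> (divU a :: 'k kTU) = of_nat (Suc a) * divU (Suc a)"
    unfolding divU_eq mult.assoc[symmetric] c by (simp add: tu_deriv_mult)
qed

lemma tu_deriv_sum: "\<partial> (sum f A) = (\<Sum>a\<in>A. \<partial> (f a))"
  by (induction A rule: infinite_finite_induct) (simp_all add: tu_deriv_add)

text \<open>On the generating series \<open>\<partial>\<close> is differentiation in the series
  variable: the coefficients \<open>a\<close> and \<open>Suc N - a\<close> add up to
  \<open>Suc N\<close>.\<close>

lemma tu_deriv_conv_TU: "\<partial> (conv_TU N) = of_nat (Suc N) * (conv_TU (Suc N) :: 'k::field_char_0 kTU)"
proof -
  let ?g = "\<lambda>a. divT a * divU (Suc N - a) :: 'k kTU"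
  have "\<partial> (conv_TU N) = (\<Sum>a\<le>N. of_nat (Suc a) * ?g (Suc a)) + (\<Sum>a\<le>N. of_nat (Suc N - a) * ?g a)"
    unfolding conv_TU_def tu_deriv_sum tu_deriv_mult tu_deriv_divT tu_deriv_divU sum.distrib
    by (intro arg_cong2[where f = "(+)"] sum.cong) (auto simp: Suc_diff_le ac_simps)
  \<comment> \<open>The terms added to align the ranges, \<open>a = 0\<close> here and
    \<open>a = Suc N\<close> next, have coefficient 0.\<close>
  also have "(\<Sum>a\<le>N. of_nat (Suc a) * ?g (Suc a)) = (\<Sum>a\<le>Suc N. of_nat a * ?g a)"
    by (subst sum.atMost_Suc_shift) simp
  also have "(\<Sum>a\<le>N. of_nat (Suc N - a) * ?g a) = (\<Sum>a\<le>Suc N. of_nat (Suc N - a) * ?g a)"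
    by simp
  also have "(\<Sum>a\<le>Suc N. of_nat a * ?g a) + (\<Sum>a\<le>Suc N. of_nat (Suc N - a) * ?g a)
      = (\<Sum>a\<le>Suc N. of_nat (Suc N) * ?g a)"
    unfolding sum.distrib[symmetric] distrib_right[symmetric] of_nat_add[symmetric]
    by (intro sum.cong) auto
  finally show ?thesis unfolding conv_TU_def sum_distrib_left .
qed

lemma tu_deriv_funpow: "(\<partial> ^^ n) (T 0 * U 0) = const (fact n) * (conv_TU n :: 'k::field_char_0 kTU)"
proof (induction n)
  case 0
  then show ?case by (simp add: conv_TU_def T_eq U_eq)
next
  case (Suc n)
  have "const (fact n) * of_nat (Suc n) = (const (fact (Suc n)) :: 'k kTU)"
    unfolding of_nat_kTU mult_single by (simp add: algebra_simps)
  then show ?case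
    by (simp add: Suc tu_deriv_mult tu_deriv_conv_TU mult.assoc[symmetric] del: of_nat_Suc fact_Suc)
qed

lemma conv_TU_mem: "conv_TU N \<in> (diff_ideal (T 0 * U 0) :: 'k::field_char_0 kTU set)"
proof -
  have "const (1 / fact N) * (\<partial> ^^ N) (T 0 * U 0) \<in> (diff_ideal (T 0 * U 0) :: 'k kTU set)"
    unfolding diff_ideal_eq_span by (intro ideal.span_scale ideal.span_base rangeI)
  also have "const (1 / fact N) * (\<partial> ^^ N) (T 0 * U 0) = (conv_TU N :: 'k kTU)"
    unfolding tu_deriv_funpow mult.assoc[symmetric] mult_single by simp
  finally show ?thesis .
qed

lemma subspace_diff_ideal: "ideal.subspace (diff_ideal f)"
  unfolding diff_ideal_eq_span by (rule ideal.subspace_span)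

lemma power_mem_diff_ideal:
  "(T i * U j) ^ (i + j + 1) \<in> (diff_ideal (T 0 * U 0) :: 'k::field_char_0 kTU set)"
proof -
  let ?I = "diff_ideal (T 0 * U 0) :: 'k kTU set"
  have "(divT i * divU j) ^ (i + j + 1) \<in> ?I"
    using conv_TU_mem unfolding conv_TU_def by (intro power_mult_mem subspace_diff_ideal)
  from ideal.subspace_scale[OF subspace_diff_ideal this, of "(const (fact i) * const (fact j)) ^ (i + j + 1)"]
  show ?thesis
    unfolding power_mult_distrib[symmetric] T_eq U_eq by (simp only: ac_simps)
qed

section \<open>The lower bound\<close>

definition row :: "nat \<Rightarrow> (nat \<times> nat) set \<Rightarrow> nat \<Rightarrow> nat" where
  "row n M r = card {c. c < n \<and> (r, c) \<in> M}"

text \<open>\<open>row\<close> and \<open>cocol\<close> are the exponents of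
  \<open>s\<^sub>r\<close> and \<open>t\<^sub>c\<close> in the term chosen by \<open>M\<close>;
  hence columns count zeros.\<close>

definition cocol :: "nat \<Rightarrow> (nat \<times> nat) set \<Rightarrow> nat \<Rightarrow> nat" where
  "cocol n M c = card {r. r < n \<and> (r, c) \<notin> M}"

abbreviation mvar :: "diff_var \<Rightarrow> diff_var \<Rightarrow>\<^sub>0 nat" where
  "mvar v \<equiv> Poly_Mapping.single v 1"

text \<open>
  A set \<open>M\<close> stands for the choice of \<open>s\<^sub>r\<close> in the factors \<open>s\<^sub>r - t\<^sub>c\<close> with \<open>(r, c) \<in> M\<close> and of \<open>- t\<^sub>c\<close> in
  the others, so the sign below differs from that of the expansion by the constant \<open>(- 1)\<^bsup>n n\<^esup>\<close>.
\<close>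
definition mon :: "nat \<Rightarrow> (nat \<times> nat) set \<Rightarrow> diff_var \<Rightarrow>\<^sub>0 nat" where
  "mon n M = (\<Sum>r<n. mvar (TVar (row n M r))) + (\<Sum>c<n. mvar (UVar (cocol n M c)))"

primrec index :: "diff_var \<Rightarrow> nat" where
  "index (TVar a) = a"
| "index (UVar a) = a"

text \<open>
  The first factorial counts the ways of distributing equal variables over the rows (or columns);
  the second undoes the division by factorials in \<^const>\<open>divT\<close> and \<^const>\<open>divU\<close>.
\<close>
definition kappa :: "(diff_var \<Rightarrow>\<^sub>0 nat) \<Rightarrow> nat" where
  "kappa m = (\<Prod>v\<in>Poly_Mapping.keys m. fact (Poly_Mapping.lookup m v) * fact (index v) ^ Poly_Mapping.lookup m v)"

definition pairing :: "nat \<Rightarrow> 'k::comm_ring_1 kTU \<Rightarrow> 'k" where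
  "pairing n p = (\<Sum>M\<in>Pow ({..<n} \<times> {..<n}).
     (- 1) ^ card M * of_nat (kappa (mon n M)) * Poly_Mapping.lookup p (mon n M))"

lemma kappa_superset:
  assumes "finite A" "Poly_Mapping.keys m \<subseteq> A"
  shows "kappa m = (\<Prod>v\<in>A. fact (Poly_Mapping.lookup m v) * fact (index v) ^ Poly_Mapping.lookup m v)"
  unfolding kappa_def using assms by (intro prod.mono_neutral_left) (auto simp: in_keys_iff)

text \<open>In the pairing, the \<open>Suc\<close> factor becomes the number of rows or columns that
  yield \<open>v\<close>, and \<open>fact (index v)\<close> cancels the denominator of
  \<open>divT\<close> or \<open>divU\<close>.\<close>

lemma kappa_add_mvar:
  "kappa (m + mvar v) = kappa m * Suc (Poly_Mapping.lookup m v) * fact (index v)"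
proof -
  let ?A = "insert v (Poly_Mapping.keys m)"
  have A: "finite ?A" "Poly_Mapping.keys m \<subseteq> ?A" "Poly_Mapping.keys (m + mvar v) \<subseteq> ?A"
    using keys_add[of m "mvar v"] by auto
  have rest: "(\<Prod>u\<in>Poly_Mapping.keys m - {v}. fact (Poly_Mapping.lookup (m + mvar v) u) * fact (index u) ^ Poly_Mapping.lookup (m + mvar v) u)
      = (\<Prod>u\<in>Poly_Mapping.keys m - {v}. fact (Poly_Mapping.lookup m u) * fact (index u) ^ Poly_Mapping.lookup m u :: nat)"
    by (intro prod.cong) (auto simp: lookup_add lookup_single when_def)
  show ?thesis
    unfolding kappa_superset[OF A(1,2)] kappa_superset[OF A(1,3)]
    unfolding prod.insert_remove[OF finite_keys] rest
    by (simp add: lookup_add lookup_single when_def algebra_simps)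
qed

lemma kappa_pos: "kappa m > 0"
  unfolding kappa_def by (intro prod_pos) simp

lemma lookup_mon_T: "Poly_Mapping.lookup (mon n M) (TVar a) = card {r. r < n \<and> row n M r = a}"
  and lookup_mon_U: "Poly_Mapping.lookup (mon n M) (UVar a) = card {c. c < n \<and> cocol n M c = a}"
  by (simp_all add: mon_def lookup_add lookup_sum lookup_single when_def sum.If_cases Int_def)

lemma pairing_add: "pairing n (p + q) = pairing n p + pairing n q"
  by (simp add: pairing_def lookup_add distrib_left sum.distrib)

lemma pairing_zero: "pairing n 0 = 0"
  by (simp add: pairing_def)

lemma pairing_sum: "pairing n (sum f A) = (\<Sum>a\<in>A. pairing n (f a))"
  by (induction A rule: infinite_finite_induct) (simp_all add: pairing_add pairing_zero)

lemma pairing_single: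
  "pairing n (Poly_Mapping.single m d) = (\<Sum>M\<in>Pow ({..<n} \<times> {..<n}).
     if mon n M = m then (- 1) ^ card M * of_nat (kappa m) * d else 0)"
  unfolding pairing_def by (intro sum.cong) (auto simp: lookup_single when_def)

section \<open>Cancellation on multiples of the generators\<close>

definition rest :: "nat \<Rightarrow> (nat \<times> nat) set \<Rightarrow> nat \<Rightarrow> nat \<Rightarrow> diff_var \<Rightarrow>\<^sub>0 nat" where
  "rest n M r c = (\<Sum>r'\<in>{..<n} - {r}. mvar (TVar (row n M r'))) + (\<Sum>c'\<in>{..<n} - {c}. mvar (UVar (cocol n M c')))"

lemma mon_eq_rest:
  assumes "r < n" "c < n"
  shows "mon n M = rest n M r c + mvar (TVar (row n M r)) + mvar (UVar (cocol n M c))"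
proof -
  have "(\<Sum>r<n. mvar (TVar (row n M r))) = mvar (TVar (row n M r)) + (\<Sum>r'\<in>{..<n} - {r}. mvar (TVar (row n M r')))"
    and "(\<Sum>c<n. mvar (UVar (cocol n M c))) = mvar (UVar (cocol n M c)) + (\<Sum>c'\<in>{..<n} - {c}. mvar (UVar (cocol n M c')))"
    using assms by (auto intro: sum.remove)
  then show ?thesis unfolding mon_def rest_def by (simp add: ac_simps)
qed

text \<open>The entry \<open>(r, c)\<close> is seen only by row \<open>r\<close> and column
  \<open>c\<close>, whose variables \<open>rest\<close> omits.\<close>

lemma rest_insert: "rest n (insert (r, c) M) r c = rest n M r c"
  unfolding rest_def row_def cocol_def
  by (intro arg_cong2[where f = "(+)"] sum.cong arg_cong[where f = mvar] arg_cong[where f = TVar]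
      arg_cong[where f = UVar] arg_cong[where f = card]) auto

lemma row_cocol_insert:
  assumes "r < n" "c < n" "(r, c) \<notin> M"
  shows "row n (insert (r, c) M) r + cocol n (insert (r, c) M) c = row n M r + cocol n M c"
proof -
  have "{c'. c' < n \<and> (r, c') \<in> insert (r, c) M} = insert c {c'. c' < n \<and> (r, c') \<in> M}"
    and "{r'. r' < n \<and> (r', c) \<notin> M} = insert r {r'. r' < n \<and> (r', c) \<notin> insert (r, c) M}"
    using assms by auto
  then show ?thesis using assms unfolding row_def cocol_def by simp
qed

text \<open>Flipping the entry \<open>(r, c)\<close> keeps the condition and reverses the sign. This
  is the vanishing of the product at \<open>s\<^sub>r = t\<^sub>c\<close>, read off at one
  coefficient.\<close>

lemma toggle_cancel:
  fixes n N r c :: nat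
  assumes r: "r < n" and c: "c < n"
  shows "(\<Sum>M\<in>Pow ({..<n} \<times> {..<n}).
      if row n M r + cocol n M c = N \<and> rest n M r c = m then (- 1) ^ card M else 0) = (0::'k::comm_ring_1)"
    (is "sum ?F _ = 0")
proof -
  let ?S = "{..<n} \<times> {..<n} - {(r, c)}"
  have S: "{..<n} \<times> {..<n} = insert (r, c) ?S" using r c by auto
  have inj: "inj_on (insert (r, c)) (Pow ?S)" by (auto intro!: inj_onI)
  have "?F (insert (r, c) M) = - ?F M" if "M \<in> Pow ?S" for M
  proof -
    have "(r, c) \<notin> M" "finite M" using that finite_subset[of M ?S] by auto
    then show ?thesis using r c by (simp add: row_cocol_insert rest_insert)
  qed
  then have "sum ?F (insert (r, c) ` Pow ?S) = - sum ?F (Pow ?S)"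
    by (simp add: sum.reindex[OF inj] sum_negf)
  moreover have "sum ?F (Pow ({..<n} \<times> {..<n})) = sum ?F (Pow ?S) + sum ?F (insert (r, c) ` Pow ?S)"
    by (subst S, subst Pow_insert, rule sum.union_disjoint) auto
  ultimately show ?thesis by simp
qed

lemma pairing_single_conv_TU:
  "pairing n (Poly_Mapping.single m d * conv_TU N) = (0::'k::field_char_0)"
proof -
  let ?P = "Pow ({..<n} \<times> {..<n})"
  let ?m = "\<lambda>a. m + mvar (TVar a) + mvar (UVar (N - a))"
  let ?i = "\<lambda>P. if P then 1 else 0 :: 'k"
  \<comment> \<open>Beyond \<open>kappa m\<close>, the weight \<open>kappa (?m a)\<close> contains
    the number of pairs \<open>(r, c)\<close> with row sum \<open>a\<close> and \<open>N - a\<close>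
    zeros in the column, so the term can be spread over these pairs.\<close>
  have t: "pairing n (Poly_Mapping.single m d * (divT a * divU (N - a))) =
      (\<Sum>M\<in>?P. \<Sum>r<n. \<Sum>c<n. of_nat (kappa m) * d *
        ((- 1) ^ card M * ?i (mon n M = ?m a \<and> row n M r = a \<and> cocol n M c = N - a)))" for a
  proof -
    have "Poly_Mapping.single m d * (divT a * divU (N - a)) =
        Poly_Mapping.single (?m a) (d / (fact a * fact (N - a)))"
      by (simp add: divT_def divU_def mult_single ac_simps)
    also have "pairing n \<dots> = (\<Sum>M\<in>?P. \<Sum>r<n. \<Sum>c<n. of_nat (kappa m) * d *
        ((- 1) ^ card M * ?i (mon n M = ?m a \<and> row n M r = a \<and> cocol n M c = N - a)))"
      unfolding pairing_single
    proof (rule sum.cong[OF refl])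
      fix M assume "M \<in> ?P"
      show "(if mon n M = ?m a then (- 1) ^ card M * of_nat (kappa (?m a)) * (d / (fact a * fact (N - a))) else 0)
        = (\<Sum>r<n. \<Sum>c<n. of_nat (kappa m) * d *
            ((- 1) ^ card M * ?i (mon n M = ?m a \<and> row n M r = a \<and> cocol n M c = N - a)))"
      proof (cases "mon n M = ?m a")
        case True
        let ?cr = "card {r. r < n \<and> row n M r = a}" and ?cc = "card {c. c < n \<and> cocol n M c = N - a}"
        have "Suc (Poly_Mapping.lookup m (TVar a)) = card {r. r < n \<and> row n M r = a}"
          unfolding lookup_mon_T[symmetric] True by (simp add: lookup_add lookup_single when_def)
        moreover have "Suc (Poly_Mapping.lookup m (UVar (N - a))) = card {c. c < n \<and> cocol n M c = N - a}"
          unfolding lookup_mon_U[symmetric] True by (simp add: lookup_add lookup_single when_def)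
        ultimately have kappa: "kappa (?m a) = kappa m * ?cr * ?cc * fact a * fact (N - a)"
          unfolding kappa_add_mvar by (simp add: lookup_add lookup_single ac_simps del: mult_Suc_right mult_Suc)
        have "(\<Sum>r<n. \<Sum>c<n. ?i (row n M r = a \<and> cocol n M c = N - a)) =
            (\<Sum>r<n. ?i (row n M r = a)) * (\<Sum>c<n. ?i (cocol n M c = N - a))"
          unfolding sum_product by (intro sum.cong) auto
        also have "\<dots> = of_nat ?cr * of_nat ?cc"
          by (simp add: sum.If_cases Int_def)
        finally have count: "(\<Sum>r<n. \<Sum>c<n. ?i (row n M r = a \<and> cocol n M c = N - a)) = of_nat ?cr * of_nat ?cc" .
        have "(- 1) ^ card M * of_nat (kappa (?m a)) * (d / (fact a * fact (N - a))) =
            of_nat (kappa m) * d * ((- 1) ^ card M * (of_nat ?cr * of_nat ?cc))"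
          unfolding kappa by simp
        also have "\<dots> = (\<Sum>r<n. \<Sum>c<n. of_nat (kappa m) * d *
            ((- 1) ^ card M * ?i (row n M r = a \<and> cocol n M c = N - a)))"
          by (simp only: count[symmetric] sum_distrib_left)
        finally show ?thesis
          by (simp only: True simp_thms if_True)
      qed simp
    qed
    finally show ?thesis .
  qed
  \<comment> \<open>Only \<open>a = row n M r\<close> can contribute; cancelling its two variables
    from the monomial equation leaves \<open>rest n M r c = m\<close>.\<close>
  have u: "(\<Sum>a\<le>N. ?i (mon n M = ?m a \<and> row n M r = a \<and> cocol n M c = N - a)) =
      ?i (row n M r + cocol n M c = N \<and> rest n M r c = m)" if "r < n" "c < n" for M r c
  proof -
    have "(\<Sum>a\<le>N. ?i (mon n M = ?m a \<and> row n M r = a \<and> cocol n M c = N - a)) =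
        (\<Sum>a\<le>N. if row n M r = a then ?i (row n M r + cocol n M c = N \<and> rest n M r c = m) else 0)"
      by (intro sum.cong) (auto simp: mon_eq_rest[OF that])
    also have "\<dots> = ?i (row n M r + cocol n M c = N \<and> rest n M r c = m)"
      by auto
    finally show ?thesis .
  qed
  have "pairing n (Poly_Mapping.single m d * conv_TU N) =
     (\<Sum>a\<le>N. \<Sum>M\<in>?P. \<Sum>r<n. \<Sum>c<n. of_nat (kappa m) * d *
        ((- 1) ^ card M * ?i (mon n M = ?m a \<and> row n M r = a \<and> cocol n M c = N - a)))"
    unfolding conv_TU_def sum_distrib_left pairing_sum t ..
  also have "\<dots> = (\<Sum>M\<in>?P. \<Sum>r<n. \<Sum>c<n. \<Sum>a\<le>N. of_nat (kappa m) * d *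
        ((- 1) ^ card M * ?i (mon n M = ?m a \<and> row n M r = a \<and> cocol n M c = N - a)))"
    by (simp only: sum.swap[of _ _ "{..N}"])
  also have "\<dots> = (\<Sum>M\<in>?P. \<Sum>r<n. \<Sum>c<n. of_nat (kappa m) * d *
        ((- 1) ^ card M * ?i (row n M r + cocol n M c = N \<and> rest n M r c = m)))"
    by (intro sum.cong refl) (simp only: sum_distrib_left[symmetric] u lessThan_iff)
  also have "\<dots> = (\<Sum>r<n. \<Sum>c<n. \<Sum>M\<in>?P. of_nat (kappa m) * d *
        ((- 1) ^ card M * ?i (row n M r + cocol n M c = N \<and> rest n M r c = m)))"
    by (simp only: sum.swap[of _ _ ?P])
  also have "\<dots> = (\<Sum>r<n. \<Sum>c<n. of_nat (kappa m) * d * (\<Sum>M\<in>?P.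
        if row n M r + cocol n M c = N \<and> rest n M r c = m then (- 1) ^ card M else 0))"
    unfolding sum_distrib_left by (intro sum.cong) auto
  also have "\<dots> = 0"
    by (intro sum.neutral ballI) (simp only: toggle_cancel lessThan_iff mult_zero_right)
  finally show ?thesis .
qed

lemma pairing_diff_ideal:
  assumes "p \<in> diff_ideal (T 0 * U 0)"
  shows "pairing n p = (0::'k::field_char_0)"
  using assms unfolding diff_ideal_eq_span
proof (induction rule: ideal.span_induct_alt)
  case base
  then show ?case by (rule pairing_zero)
next
  case (step c x y)
  then obtain N where x: "x = const (fact N) * conv_TU N" by (auto simp: tu_deriv_funpow)
  have "pairing n (c' * conv_TU N) = 0" for c' :: "'k kTU"
    by (induction c' rule: kTU_induct) (simp_all add: pairing_single_conv_TU distrib_right pairing_add)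
  from this[of "c * const (fact N)"] show ?case
    by (simp add: pairing_add step x mult.assoc)
qed

section \<open>Regular 0-1 matrices and non-vanishing\<close>

lemma card_shift_mod:
  assumes "i \<le> n"
  shows "card {c. c < n \<and> (r + c) mod n < i} = (i::nat)"
proof (cases "n = 0")
  case False
  \<comment> \<open>This map permutes \<open>{..<n}\<close>, so the set to be counted is the
    preimage of \<open>{..<i}\<close>.\<close>
  let ?f = "\<lambda>c. (r + c) mod n"
  have inj: "inj_on ?f {..<n}"
  proof (rule inj_onI)
    fix a b assume ab: "a \<in> {..<n}" "b \<in> {..<n}" "?f a = ?f b"
    have "(int r + int a) mod int n = (int r + int b) mod int n"
      using ab(3) by (metis of_nat_add of_nat_mod)
    then have "int n dvd int a - int b"
      by (simp add: mod_eq_dvd_iff)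
    then have "int a mod int n = int b mod int n"
      by (simp add: mod_eq_dvd_iff)
    then show "a = b" using ab(1,2) by simp
  qed
  have "?f ` {..<n} \<subseteq> {..<n}" using False by auto
  then have surj: "?f ` {..<n} = {..<n}"
    using inj by (intro endo_inj_surj) auto
  have "?f ` {c. c < n \<and> ?f c < i} = {..<i}"
  proof (intro equalityI subsetI)
    fix k assume "k \<in> {..<i}"
    then have "k \<in> ?f ` {..<n}" using surj assms by simp
    then show "k \<in> ?f ` {c. c < n \<and> ?f c < i}" using \<open>k \<in> {..<i}\<close> by auto
  qed auto
  moreover have "inj_on ?f {c. c < n \<and> ?f c < i}"
    by (rule inj_on_subset[OF inj]) auto
  ultimately show ?thesis by (metis card_image card_lessThan)
qed (use assms in auto)

lemma regular_matrix_exists: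
  assumes "i + j = n"
  shows "\<exists>M \<subseteq> {..<n} \<times> {..<n}. (\<forall>r<n. row n M r = i) \<and> (\<forall>c<n. cocol n M c = j)"
proof (intro exI conjI allI impI)
  \<comment> \<open>The circulant matrix is symmetric in \<open>r\<close> and \<open>c\<close>, so
    one count serves rows and columns.\<close>
  let ?M = "{(r, c). r < n \<and> c < n \<and> (r + c) mod n < i}"
  show "?M \<subseteq> {..<n} \<times> {..<n}" by auto
  show "row n ?M r = i" if "r < n" for r
    using that card_shift_mod[of i n r] assms by (simp add: row_def conj_commute)
  show "cocol n ?M c = j" if "c < n" for c
  proof -
    have "{r. r < n \<and> (r, c) \<notin> ?M} = {..<n} - {r. r < n \<and> (c + r) mod n < i}"
      using that by (auto simp: add.commute)
    moreover have "card ({..<n} - {r. r < n \<and> (c + r) mod n < i}) = card {..<n} - card {r. r < n \<and> (c + r) mod n < i}"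
      by (rule card_Diff_subset) auto
    moreover have "card {r. r < n \<and> (c + r) mod n < i} = i"
      using assms by (intro card_shift_mod) simp
    ultimately show ?thesis
      using assms unfolding cocol_def by simp
  qed
qed

lemma pairing_power_neq_0:
  assumes n: "n = i + j"
  shows "pairing n ((T i * U j) ^ n) \<noteq> (0::'k::field_char_0)"
proof -
  let ?m = "Poly_Mapping.single (TVar i) n + Poly_Mapping.single (UVar j) n"
  let ?P = "Pow ({..<n} \<times> {..<n})"
  have pow: "(T i * U j) ^ k = Poly_Mapping.single (Poly_Mapping.single (TVar i) k + Poly_Mapping.single (UVar j) k) (1::'k)" for k
    proof (induction k)
    case (Suc k)
    have "Poly_Mapping.single v (Suc k) = mvar v + Poly_Mapping.single v k" for v
      by (simp flip: single_add)
    then show ?case unfolding power_Suc Suc.IH by (simp add: var_def mult_single ac_simps)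
  qed simp
  \<comment> \<open>All contributing matrices have equally many entries and thus the same sign, so
    nothing cancels.\<close>
  have card: "card M = n * i" if "M \<in> ?P" "mon n M = ?m" for M
  proof -
    have "card {r. r < n \<and> row n M r = i} = n"
      unfolding lookup_mon_T[symmetric] that(2) by (simp add: lookup_add lookup_single)
    then have "{r. r < n \<and> row n M r = i} = {..<n}"
      by (intro card_subset_eq) auto
    then have "\<forall>r\<in>{..<n}. row n M r = i" by blast
    then have "(\<Sum>r<n. row n M r) = n * i" by simp
    moreover have "M = (SIGMA r:{..<n}. {c. c < n \<and> (r, c) \<in> M})" using that by auto
    moreover have "card (SIGMA r:{..<n}. {c. c < n \<and> (r, c) \<in> M}) = (\<Sum>r<n. row n M r)"
      unfolding row_def by (intro card_SigmaI) auto
    ultimately show ?thesis by metis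
  qed
  have "pairing n ((T i * U j) ^ n) = (\<Sum>M\<in>?P. if mon n M = ?m then (- 1) ^ (n * i) * of_nat (kappa ?m) else (0::'k))"
    unfolding pow pairing_single by (intro sum.cong) (auto simp: card)
  also have "\<dots> = of_nat (card {M \<in> ?P. mon n M = ?m}) * ((- 1) ^ (n * i) * of_nat (kappa ?m))"
    by (simp add: sum.If_cases Int_def)
  also have "\<dots> \<noteq> 0"
  proof -
    \<comment> \<open>One matrix suffices: a positive count is non-zero in characteristic
      zero.\<close>
    obtain M where M: "M \<in> ?P" "\<forall>r<n. row n M r = i" "\<forall>c<n. cocol n M c = j"
      using regular_matrix_exists[of i j n] n by auto
    have s: "(\<Sum>r<k. mvar v) = Poly_Mapping.single v k" for k v
      by (induction k) (simp_all add: single_add[symmetric])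
    have "mon n M = (\<Sum>r<n. mvar (TVar i)) + (\<Sum>c<n. mvar (UVar j))"
      unfolding mon_def using M(2,3) by (intro arg_cong2[where f = "(+)"] sum.cong) simp_all
    then have "mon n M = ?m" unfolding s .
    then have "{M \<in> ?P. mon n M = ?m} \<noteq> {}" using M(1) by blast
    moreover have "finite {M \<in> ?P. mon n M = ?m}"
      by (rule finite_subset[of _ ?P]) (rule Collect_restrict, rule finite_Pow_iff[THEN iffD2], simp)
    ultimately have "card {M \<in> ?P. mon n M = ?m} > 0"
      by (intro card_gt_0_iff[THEN iffD2] conjI)
    then show ?thesis
      using kappa_pos[of ?m]
      by (intro no_zero_divisors power_not_zero) (simp_all only: of_nat_eq_0_iff neg_equal_0_iff_equal one_neq_zero neq0_conv not_False_eq_True)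
  qed
  finally show ?thesis .
qed

theorem mainTheorem2:
  fixes i j :: nat
  defines "I \<equiv> (diff_ideal (T 0 * U 0) :: 'k::field_char_0 kTU set)"
  shows "(\<exists>q>0. (T i * U j) ^ q \<in> I) \<and> (LEAST q. 0 < q \<and> (T i * U j) ^ q \<in> I) = i + j + 1"
proof -
  have up: "(T i * U j) ^ (i + j + 1) \<in> I"
    unfolding I_def by (rule power_mem_diff_ideal)
  \<comment> \<open>Ideals absorb multiples, so excluding the exponent \<open>i + j\<close> excludes
    every smaller one.\<close>
  have "i + j + 1 \<le> q" if "(T i * U j) ^ q \<in> I" for q
  proof (rule ccontr)
    assume "\<not> i + j + 1 \<le> q"
    then have "(T i * U j) ^ (i + j) = (T i * U j) ^ (i + j - q) * (T i * U j :: 'k kTU) ^ q"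
      by (simp flip: power_add)
    then have "(T i * U j) ^ (i + j) \<in> I"
      using ideal.subspace_scale[OF subspace_diff_ideal that[unfolded I_def]] unfolding I_def by metis
    then show False
      using pairing_diff_ideal pairing_power_neq_0[OF refl] unfolding I_def by blast
  qed
  then have "(LEAST q. 0 < q \<and> (T i * U j) ^ q \<in> I) = i + j + 1"
    using up by (intro Least_equality) auto
  then show ?thesis using up by auto
qed

end
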